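(* Let $(\Omega,\mathcal{F},\mathsf{P})$ be a complete probability space, let $\mathsf{H}$ be a separable real Hilbert space, let $(\mathsf{K},\mathcal{K})$ be a measurable space, and let $\beta\in\,]0,+\infty[$. For every $\mathsf{k}\in\mathsf{K}$, let $\mathsf{f}_{\mathsf{k}}\colon\mathsf{H}\to\mathbb{R}$ be a convex differentiable function such that $\nabla\mathsf{f}_{\mathsf{k}}$ is $\beta$-Lipschitzian. Let $k\colon(\Omega,\mathcal{F},\mathsf{P})\to(\mathsf{K},\mathcal{K})$ be a random variable and set $$(\forall\mathsf{x}\in\mathsf{H})\quad\mathsf{f}(\mathsf{x})=\int_\Omega\mathsf{f}_{k(\omega)}(\mathsf{x})\,\mathsf{P}(d\omega).$$ Assume that the set $\operatorname{Argmin}\mathsf{f}$ of minimizers of $\mathsf{f}$ is nonempty and that there exists an increasing function $\psi\colon[0,+\infty[\,\to[0,+\infty[$ such that $$(\forall\mathsf{x}\in\mathsf{H})\quad\int_\Omega\|\nabla\mathsf{f}_{k(\omega)}(\mathsf{x})\|^2\,\mathsf{P}(d\omega)\leq\psi(\|\mathsf{x}\|).$$ Let $x_0\in L^2(\Omega,\mathcal{F},\mathsf{P};\mathsf{H})$, let $\mathsf{p}\in\,]2/3,1]$, and set, for every $n\in\mathbb{N}$, $\gamma_n=(n+1)^{-\mathsf{p}}$. For $n=0,1,\ldots$, let $\mathcal{F}_n$ be the sub-$\sigma$-algebra of $\mathcal{F}$ generated by $(x_0,\ldots,x_n)$, let $k_n$ be a copy of $k$ that is independent of $\mathcal{F}_n$,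 and set $$x_{n+1}=x_n-\gamma_n\nabla\mathsf{f}_{k_n}(x_n).$$ Then, $\mathsf{P}$-a.s., $$\mathsf{f}(x_n)-\inf\mathsf{f}(\mathsf{H})=\begin{cases}\mathrm{o}\Big(\dfrac{1}{n^{1-\mathsf{p}}}\Big),&\text{if }\mathsf{p}\in\,]2/3,1[\,;\\[3mm]\mathrm{o}\Big(\dfrac{1}{\ln(n)}\Big),&\text{if }\mathsf{p}=1.\end{cases}$$
   Context: $L^2(\Omega,\mathcal{F},\mathsf{P};\mathsf{H})$ is the space of (a.s. equivalence classes of) $\mathsf{H}$-valued random variables $x$ with $\mathsf{E}\|x\|^2<+\infty$. A copy of $k$ is a $(\mathsf{K},\mathcal{K})$-valued random variable on $(\Omega,\mathcal{F},\mathsf{P})$ with the same distribution as $k$. "Increasing" is understood in the wide sense (nondecreasing). The displayed formulas presuppose the measurability of $(\mathsf{k},\mathsf{x})\mapsto\mathsf{f}_{\mathsf{k}}(\mathsf{x})$ and $(\mathsf{k},\mathsf{x})\mapsto\nabla\mathsf{f}_{\mathsf{k}}(\mathsf{x})$ and the integrability of $\omega\mapsto\mathsf{f}_{k(\omega)}(\mathsf{x})$ needed for $\mathsf{f}\colon\mathsf{H}\to\mathbb{R}$ and the random variables $x_n$ to be well defined. *)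

theory Defs
  imports "HOL-Probability.Probability" "HOL-Library.Landau_Symbols"
begin

definition grad :: "('h::real_inner \<Rightarrow> real) \<Rightarrow> 'h \<Rightarrow> 'h" where
  "grad f x = (THE D. GDERIV f x :> D)"

definition generated_events :: "'w measure \<Rightarrow> (nat \<Rightarrow> 'w \<Rightarrow> 'h::topological_space) \<Rightarrow> nat \<Rightarrow> 'w set set" where
  "generated_events M x n =
     sigma_sets (space M) {x i -` B \<inter> space M | i B. i \<le> n \<and> B \<in> sets borel}"

text \<open>
  The Riesz representation theorem is used only to show that \<open>grad f x\<close> is a genuine
  gradient, and not an unspecified value, wherever \<open>f\<close> is differentiable.
\<close>

lemma riesz_representation_exists:
  fixes \<phi> :: "'h::{real_inner, complete_space} \<Rightarrow> real"
  assumes "bounded_linear \<phi>"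
  shows "\<exists>v. \<forall>h. \<phi> h = inner h v"
proof -
  interpret bounded_linear \<phi> by fact
  define J where "J v = (norm v)\<^sup>2 / 2 - \<phi> v" for v
  obtain C where C: "\<And>x. norm (\<phi> x) \<le> norm x * C" using bounded by blast
  have "- (C\<^sup>2 / 2) \<le> J v" for v
  proof -
    have "\<phi> v \<le> norm v * C" using C[of v] by simp
    moreover have "0 \<le> (norm v - C)\<^sup>2" by simp
    ultimately show ?thesis by (simp add: J_def power2_diff)
  qed
  then have bdd: "bdd_below (range J)" by (meson bdd_belowI2)
  define m where "m = Inf (range J)"
  have m: "m \<le> J v" for v unfolding m_def using bdd by (simp add: cINF_lower)
  have "\<exists>v. J v < m + inverse (real (Suc n))" for n
    using cINF_less_iff[OF _ bdd, of "m + inverse (real (Suc n))"]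
    unfolding m_def by auto
  then obtain u where u: "\<And>n. J (u n) < m + inverse (real (Suc n))" by metis
  have par: "(norm (a - b))\<^sup>2 \<le> 4 * (J a + J b - 2 * m)" for a b
  proof -
    have "J a + J b - 2 * J ((1/2) *\<^sub>R (a + b)) = (norm (a - b))\<^sup>2 / 4"
      by (simp add: J_def power2_norm_eq_inner add scaleR inner_add_left inner_add_right
          inner_diff_left inner_diff_right inner_commute field_simps)
    then show ?thesis using m[of "(1/2) *\<^sub>R (a + b)"] by simp
  qed
  have "Cauchy u"
  proof (rule metric_CauchyI)
    fix e :: real assume "e > 0"
    then obtain N where N: "inverse (real (Suc N)) < e\<^sup>2 / 8"
      using reals_Archimedean[of "e\<^sup>2 / 8"] by auto
    have "dist (u i) (u j) < e" if "i \<ge> N" "j \<ge> N" for i j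
    proof -
      have *: "inverse (real (Suc k)) \<le> inverse (real (Suc N))" if "k \<ge> N" for k
        using that by (simp add: field_simps)
      have "J (u k) < m + e\<^sup>2 / 8" if "k \<ge> N" for k
        using u[of k] *[OF that] N by argo
      then have "J (u i) < m + e\<^sup>2 / 8" "J (u j) < m + e\<^sup>2 / 8"
        using that by blast+
      then have "(norm (u i - u j))\<^sup>2 < e\<^sup>2"
        using par[of "u i" "u j"] by argo
      then show ?thesis using \<open>e > 0\<close> by (simp add: dist_norm power2_less_imp_less)
    qed
    then show "\<exists>N. \<forall>i\<ge>N. \<forall>j\<ge>N. dist (u i) (u j) < e" by blast
  qed
  then obtain v where v: "u \<longlonglongrightarrow> v" using Cauchy_convergent convergent_def by blast
  have "(\<lambda>n. J (u n)) \<longlonglongrightarrow> J v"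
    unfolding J_def by (intro tendsto_intros v tendsto) simp
  moreover have "(\<lambda>n. m + inverse (real (Suc n))) \<longlonglongrightarrow> m + 0"
    by (intro tendsto_intros LIMSEQ_inverse_real_of_nat)
  ultimately have "J v \<le> m + 0"
    by (rule LIMSEQ_le) (use u less_imp_le in blast)
  then have min: "J v \<le> J w" for w using m[of w] by simp
  have "\<phi> h = inner h v" for h
  proof (cases "h = 0")
    case True then show ?thesis by (simp add: zero)
  next
    case False
    define a where "a = inner v h - \<phi> h"
    define t where "t = - a / (norm h)\<^sup>2"
    have "J (v + t *\<^sub>R h) - J v = t * a + t\<^sup>2 * (norm h)\<^sup>2 / 2"
      unfolding J_def a_def power2_norm_eq_inner
      by (simp add: add scaleR inner_add_left inner_add_right inner_commute[of h v]
          power2_eq_square algebra_simps add_divide_distrib)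
    also have "\<dots> = - (a\<^sup>2) / (2 * (norm h)\<^sup>2)"
      using False by (simp add: t_def power2_eq_square field_simps)
    finally have "a\<^sup>2 / (2 * (norm h)\<^sup>2) \<le> 0" using min[of "v + t *\<^sub>R h"] by argo
    then have "a = 0" using False by (simp add: divide_le_0_iff)
    then show ?thesis by (simp add: a_def inner_commute)
  qed
  then show ?thesis by blast
qed

lemma GDERIV_grad:
  fixes f :: "'h::{real_inner, complete_space} \<Rightarrow> real"
  assumes "f differentiable (at x)"
  shows "GDERIV f x :> grad f x"
proof -
  obtain f' where f': "(f has_derivative f') (at x)"
    using assms differentiable_def by blast
  then obtain v where "\<forall>h. f' h = inner h v"
    using riesz_representation_exists[OF has_derivative_bounded_linear[OF f']] by blast
  then have "f' = (\<lambda>h. inner h v)" by blast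
  then have v: "GDERIV f x :> v" using f' by (simp add: gderiv_def)
  show ?thesis unfolding grad_def
  proof (rule theI[of _ v])
    fix D assume "GDERIV f x :> D"
    then have "(\<lambda>h. inner h D) = (\<lambda>h. inner h v)"
      using v has_derivative_unique unfolding gderiv_def by blast
    then show "D = v" by (metis vector_eq_ldot)
  qed (fact v)
qed

end

theory Submission
  imports Defs
begin

text \<open>
  Let \<open>z*\<close> minimize \<open>F\<close> and \<open>D = F - F z*\<close>. Expanding the square of the distance to \<open>z*\<close>, and bounding
  the second moment of the stochastic gradient by \<open>2 \<beta>\<^sup>2 \<parallel>z - z*\<parallel>\<^sup>2 + 2 \<psi> \<parallel>z*\<parallel>\<close>, shows that
  \<open>E \<parallel>x n - z*\<parallel>\<^sup>2\<close> is bounded and \<open>\<Sum> \<gamma> n * E (D (x n)) < \<infinity>\<close>. By the descent lemma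
  \<open>D (x n)\<close> increases in conditional mean by at most a multiple of \<open>(\<gamma> n)\<^sup>2\<close>. Hence, for the weights
  \<open>s n = n powr (1 - p)\<close> or \<open>s n = ln n\<close>, the process \<open>W n = s n * D (x n)\<close> is a nonnegative
  supermartingale up to summable errors; this is where \<open>p > 2/3\<close> enters, through
  \<open>\<Sum> s (n+1) * (\<gamma> n)\<^sup>2 < \<infinity>\<close>. Since \<open>\<Sum> \<gamma> n / s n = \<infinity>\<close>, summability of \<open>\<gamma> n / s n * E (W n)\<close> forces
  \<open>liminf E (W n) = 0\<close>, and the maximal inequality started at indices where \<open>E (W n)\<close> is small
  gives \<open>W n \<longlonglongrightarrow> 0\<close> almost surely, without any martingale convergence theorem.
\<close>

subsection \<open>Nonnegative almost supermartingales\<close>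

text \<open>Stop at the first time \<open>W\<close> reaches \<open>c\<close>. The event
  \<open>B j\<close> of having stayed below \<open>c\<close> up to time \<open>n + j\<close> belongs
  to \<open>\<F> (n + j)\<close>, so the drift bound applies on it, and each path that leaves it
  pays at least \<open>c\<close> out of the integral of \<open>W\<close>.\<close>

lemma (in prob_space) almost_supermartingale_maximal_inequality:
  fixes W :: "nat \<Rightarrow> 'a \<Rightarrow> real" and \<F> :: "nat \<Rightarrow> 'a set set" and e :: "nat \<Rightarrow> ennreal"
  assumes \<F>: "\<And>n. sigma_algebra (space M) (\<F> n)" "\<And>n. \<F> n \<subseteq> \<F> (Suc n)" "\<And>n. \<F> n \<subseteq> sets M"
    and W[measurable]: "\<And>n. W n \<in> borel_measurable M"
    and adapted: "\<And>n c. {\<omega>\<in>space M. W n \<omega> < c} \<in> \<F> n"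
    and drift: "\<And>n A. A \<in> \<F> n \<Longrightarrow>
      (\<integral>\<^sup>+\<omega>. ennreal (W (Suc n) \<omega>) * indicator A \<omega> \<partial>M) \<le> (\<integral>\<^sup>+\<omega>. ennreal (W n \<omega>) * indicator A \<omega> \<partial>M) + e n"
  shows "ennreal c * emeasure M {\<omega>\<in>space M. \<exists>m\<in>{n..n + j}. c \<le> W m \<omega>}
      \<le> (\<integral>\<^sup>+\<omega>. ennreal (W n \<omega>) \<partial>M) + (\<Sum>m=n..<n + j. e m)"
proof -
  define B where "B j = {\<omega>\<in>space M. \<forall>m\<in>{n..n + j}. W m \<omega> < c}" for j
  have mono: "\<F> i \<subseteq> \<F> j" if "i \<le> j" for i j
    using that by (induction rule: dec_induct) (use \<F>(2) in blast)+
  have B_\<F>: "B j \<in> \<F> (n + j)" for j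
  proof -
    interpret sigma_algebra "space M" "\<F> (n + j)" by (rule \<F>)
    show ?thesis unfolding B_def
    proof (rule sets_Collect_finite_All')
      fix m assume "m \<in> {n..n + j}"
      then have "m \<le> n + j" by simp
      then show "{\<omega>\<in>space M. W m \<omega> < c} \<in> \<F> (n + j)"
        using mono adapted by blast
    qed auto
  qed
  then have B_M[measurable]: "B j \<in> sets M" for j using \<F>(3) by blast
  have Suc_split: "{n..Suc (n + j)} = insert (Suc (n + j)) {n..n + j}" for j by auto
  \<comment> \<open>Keeping the integral over the surviving event \<open>B j\<close> on the left
    makes the induction close; it is discarded only at the end.\<close>
  have "ennreal c * emeasure M (space M - B j) + (\<integral>\<^sup>+\<omega>. ennreal (W (n + j) \<omega>) * indicator (B j) \<omega> \<partial>M)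
      \<le> (\<integral>\<^sup>+\<omega>. ennreal (W n \<omega>) \<partial>M) + (\<Sum>m=n..<n + j. e m)"
  proof (induction j)
    case 0
    have "ennreal c * emeasure M (space M - B 0) = (\<integral>\<^sup>+\<omega>. ennreal c * indicator (space M - B 0) \<omega> \<partial>M)"
      by (simp add: nn_integral_cmult_indicator)
    then have "ennreal c * emeasure M (space M - B 0) + (\<integral>\<^sup>+\<omega>. ennreal (W n \<omega>) * indicator (B 0) \<omega> \<partial>M)
        = (\<integral>\<^sup>+\<omega>. ennreal c * indicator (space M - B 0) \<omega> + ennreal (W n \<omega>) * indicator (B 0) \<omega> \<partial>M)"
      by (simp add: nn_integral_add)
    also have "\<dots> \<le> (\<integral>\<^sup>+\<omega>. ennreal (W n \<omega>) \<partial>M)"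
      by (intro nn_integral_mono) (auto simp: B_def indicator_def not_less intro: ennreal_leI)
    finally show ?case by simp
  next
    case (Suc j)
    let ?C = "B j - B (Suc j)"
    have "ennreal c * emeasure M ?C + (\<integral>\<^sup>+\<omega>. ennreal (W (n + Suc j) \<omega>) * indicator (B (Suc j)) \<omega> \<partial>M)
        = (\<integral>\<^sup>+\<omega>. ennreal c * indicator ?C \<omega> + ennreal (W (n + Suc j) \<omega>) * indicator (B (Suc j)) \<omega> \<partial>M)"
      by (simp add: nn_integral_add nn_integral_cmult_indicator)
    also have "\<dots> \<le> (\<integral>\<^sup>+\<omega>. ennreal (W (Suc (n + j)) \<omega>) * indicator (B j) \<omega> \<partial>M)"
    proof (intro nn_integral_mono)
      fix \<omega> assume "\<omega> \<in> space M"
      then show "ennreal c * indicator ?C \<omega> + ennreal (W (n + Suc j) \<omega>) * indicator (B (Suc j)) \<omega>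
          \<le> ennreal (W (Suc (n + j)) \<omega>) * indicator (B j) \<omega>"
        by (auto simp: B_def indicator_def Suc_split not_less intro: ennreal_leI)
    qed
    also have "\<dots> \<le> (\<integral>\<^sup>+\<omega>. ennreal (W (n + j) \<omega>) * indicator (B j) \<omega> \<partial>M) + e (n + j)"
      by (rule drift[OF B_\<F>])
    finally have *: "ennreal c * emeasure M ?C
          + (\<integral>\<^sup>+\<omega>. ennreal (W (n + Suc j) \<omega>) * indicator (B (Suc j)) \<omega> \<partial>M)
        \<le> (\<integral>\<^sup>+\<omega>. ennreal (W (n + j) \<omega>) * indicator (B j) \<omega> \<partial>M) + e (n + j)" .
    have "B (Suc j) \<subseteq> B j" by (auto simp: B_def)
    then have "space M - B (Suc j) = (space M - B j) \<union> ?C" by (auto simp: B_def)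
    also have "emeasure M \<dots> = emeasure M (space M - B j) + emeasure M ?C"
      by (rule plus_emeasure[symmetric]) auto
    finally have "ennreal c * emeasure M (space M - B (Suc j))
          + (\<integral>\<^sup>+\<omega>. ennreal (W (n + Suc j) \<omega>) * indicator (B (Suc j)) \<omega> \<partial>M)
        = ennreal c * emeasure M (space M - B j) + (ennreal c * emeasure M ?C
          + (\<integral>\<^sup>+\<omega>. ennreal (W (n + Suc j) \<omega>) * indicator (B (Suc j)) \<omega> \<partial>M))"
      by (simp add: distrib_left add.assoc)
    also have "\<dots> \<le> ennreal c * emeasure M (space M - B j)
        + ((\<integral>\<^sup>+\<omega>. ennreal (W (n + j) \<omega>) * indicator (B j) \<omega> \<partial>M) + e (n + j))"
      using * by (rule add_left_mono)
    also have "\<dots> \<le> (\<integral>\<^sup>+\<omega>. ennreal (W n \<omega>) \<partial>M) + (\<Sum>m=n..<n + j. e m) + e (n + j)"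
      using add_right_mono[OF Suc.IH, of "e (n + j)"] by (simp only: add.assoc)
    finally show ?case by (simp add: add.assoc)
  qed
  moreover have "{\<omega>\<in>space M. \<exists>m\<in>{n..n + j}. c \<le> W m \<omega>} = space M - B j"
    by (auto simp: B_def not_less)
  ultimately show ?thesis by (metis (no_types, lifting) le_iff_add order_trans)
qed

text \<open>The maximal inequality is started at an index where both the mean of \<open>W\<close>
  and the tail sum of \<open>e\<close> are small. For each \<open>c > 0\<close> the event that
  \<open>W\<close> reaches \<open>c\<close> infinitely often then has arbitrarily small
  probability.\<close>

lemma (in prob_space) almost_supermartingale_tendsto_0:
  fixes W :: "nat \<Rightarrow> 'a \<Rightarrow> real" and \<F> :: "nat \<Rightarrow> 'a set set" and e :: "nat \<Rightarrow> real"
  assumes \<F>: "\<And>n. sigma_algebra (space M) (\<F> n)" "\<And>n. \<F> n \<subseteq> \<F> (Suc n)" "\<And>n. \<F> n \<subseteq> sets M"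
    and W[measurable]: "\<And>n. W n \<in> borel_measurable M"
    and adapted: "\<And>n c. {\<omega>\<in>space M. W n \<omega> < c} \<in> \<F> n"
    and nonneg: "\<And>n \<omega>. 0 \<le> W n \<omega>"
    and drift: "\<And>n A. A \<in> \<F> n \<Longrightarrow>
      (\<integral>\<^sup>+\<omega>. ennreal (W (Suc n) \<omega>) * indicator A \<omega> \<partial>M)
        \<le> (\<integral>\<^sup>+\<omega>. ennreal (W n \<omega>) * indicator A \<omega> \<partial>M) + ennreal (e n)"
    and e: "\<And>n. 0 \<le> e n" "summable e"
    and small: "\<And>\<delta> N. 0 < \<delta> \<Longrightarrow> \<exists>n\<ge>N. (\<integral>\<^sup>+\<omega>. ennreal (W n \<omega>) \<partial>M) \<le> ennreal \<delta>"
  shows "AE \<omega> in M. (\<lambda>n. W n \<omega>) \<longlonglongrightarrow> 0"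
proof -
  have ev: "AE \<omega> in M. \<exists>n. \<forall>m\<ge>n. W m \<omega> < c" if c: "0 < c" for c
  proof -
    define Z where "Z n = {\<omega>\<in>space M. \<exists>m\<ge>n. c \<le> W m \<omega>}" for n
    have [measurable]: "Z n \<in> sets M" for n unfolding Z_def by measurable
    have max: "ennreal c * emeasure M {\<omega>\<in>space M. \<exists>m\<in>{n..n + j}. c \<le> W m \<omega>}
        \<le> (\<integral>\<^sup>+\<omega>. ennreal (W n \<omega>) \<partial>M) + (\<Sum>m=n..<n + j. ennreal (e m))" for n j
      by (rule almost_supermartingale_maximal_inequality[where \<F> = \<F>]) (fact \<F> W adapted drift)+
    have Z_le: "ennreal c * emeasure M (Z n) \<le> (\<integral>\<^sup>+\<omega>. ennreal (W n \<omega>) \<partial>M) + ennreal (\<Sum>m. e (m + n))" for n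
    proof -
      define Y where "Y j = {\<omega>\<in>space M. \<exists>m\<in>{n..n + j}. c \<le> W m \<omega>}" for j
      have [measurable]: "Y j \<in> sets M" for j unfolding Y_def by measurable
      have Z_Y: "Z n = (\<Union>j. Y j)"
        unfolding Z_def Y_def by (auto, metis add_diff_inverse_nat atLeastAtMost_iff not_less order_refl)
      have "incseq Y" unfolding incseq_def Y_def by force
      then have "emeasure M (Z n) = (SUP j. emeasure M (Y j))"
        unfolding Z_Y by (intro SUP_emeasure_incseq[symmetric]) auto
      then have "ennreal c * emeasure M (Z n) = (SUP j. ennreal c * emeasure M (Y j))"
        by (simp add: SUP_mult_left_ennreal)
      also have "\<dots> \<le> (\<integral>\<^sup>+\<omega>. ennreal (W n \<omega>) \<partial>M) + ennreal (\<Sum>m. e (m + n))"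
      proof (rule SUP_least)
        fix j
        have "(\<Sum>m=n..<n + j. ennreal (e m)) = ennreal (\<Sum>m=n..<n + j. e m)"
          using e(1) by (intro sum_ennreal) auto
        also have "(\<Sum>m=n..<n + j. e m) = (\<Sum>m<j. e (m + n))"
          using sum.shift_bounds_nat_ivl[of e 0 n j] by (simp add: add.commute atLeast0LessThan)
        also have "ennreal \<dots> \<le> ennreal (\<Sum>m. e (m + n))"
          using e by (intro ennreal_leI sum_le_suminf) (auto simp: summable_iff_shift)
        finally have "(\<Sum>m=n..<n + j. ennreal (e m)) \<le> ennreal (\<Sum>m. e (m + n))" .
        then show "ennreal c * emeasure M (Y j) \<le> (\<integral>\<^sup>+\<omega>. ennreal (W n \<omega>) \<partial>M) + ennreal (\<Sum>m. e (m + n))"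
          unfolding Y_def
          by (rule order_trans[OF max add_left_mono])
      qed
      finally show ?thesis .
    qed
    define L where "L = (\<Inter>n. Z n)"
    have [measurable]: "L \<in> sets M" unfolding L_def by measurable
    have "ennreal c * emeasure M L \<le> 0 + ennreal \<delta>" if "0 < \<delta>" for \<delta>
    proof -
      obtain N where N: "norm (\<Sum>i. e (i + N')) < \<delta> / 2" if "N' \<ge> N" for N'
        using suminf_exist_split[OF _ e(2), of "\<delta> / 2"] \<open>0 < \<delta>\<close> by auto
      obtain n where n: "n \<ge> N" "(\<integral>\<^sup>+\<omega>. ennreal (W n \<omega>) \<partial>M) \<le> ennreal (\<delta> / 2)"
        using small[of "\<delta> / 2" N] \<open>0 < \<delta>\<close> by auto
      have "ennreal c * emeasure M L \<le> ennreal c * emeasure M (Z n)"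
        by (intro mult_left_mono emeasure_mono) (auto simp: L_def)
      also have "\<dots> \<le> ennreal (\<delta> / 2) + ennreal (\<delta> / 2)"
        using Z_le[of n] n N[OF n(1)] by (intro order_trans[OF Z_le] add_mono) (auto intro!: ennreal_leI)
      also have "\<dots> = ennreal \<delta>" using \<open>0 < \<delta>\<close> by (simp flip: ennreal_plus)
      finally show ?thesis by simp
    qed
    then have "ennreal c * emeasure M L \<le> 0"
      by (rule ennreal_le_epsilon)
    then have "L \<in> null_sets M" using c by (auto simp: null_sets_def ennreal_eq_0_iff)
    then show ?thesis
      by (rule AE_I') (auto simp: L_def Z_def not_less)
  qed
  \<comment> \<open>Countably many levels suffice, so the exceptional null sets can be
    united.\<close>
  have "AE \<omega> in M. \<forall>i. \<exists>n. \<forall>m\<ge>n. W m \<omega> < inverse (real (Suc i))"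
    by (subst AE_all_countable) (auto intro!: ev)
  then show ?thesis
  proof eventually_elim
    case (elim \<omega>)
    show ?case
    proof (rule LIMSEQ_I)
      fix r :: real assume "0 < r"
      then obtain i where "inverse (real (Suc i)) < r" using reals_Archimedean by blast
      moreover obtain n where "\<forall>m\<ge>n. W m \<omega> < inverse (real (Suc i))" using elim by blast
      ultimately show "\<exists>no. \<forall>n\<ge>no. norm (W n \<omega> - 0) < r"
        using nonneg by (intro exI[of _ n]) force
    qed
  qed
qed

section \<open>Tools on independence, completeness and convexity\<close>

text \<open>Independence makes the joint law of \<open>(X, Y)\<close> on the event \<open>A\<close>
  a product, and Tonelli's theorem then integrates \<open>X\<close> out with \<open>Y\<close>
  frozen. With \<open>A\<close> ranging over a sigma-algebra this does the work of a conditional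
  expectation.\<close>

lemma (in prob_space) nn_integral_indep_freeze:
  assumes [measurable]: "X \<in> measurable M K" "Y \<in> measurable M L" "A \<in> sets M"
    and h[measurable]: "h \<in> borel_measurable (K \<Otimes>\<^sub>M L)"
    and indep: "\<And>B C. B \<in> sets K \<Longrightarrow> C \<in> sets L \<Longrightarrow>
      prob ((X -` B \<inter> space M) \<inter> (Y -` C \<inter> A)) = prob (X -` B \<inter> space M) * prob (Y -` C \<inter> A)"
  shows "(\<integral>\<^sup>+\<omega>. h (X \<omega>, Y \<omega>) * indicator A \<omega> \<partial>M)
    = (\<integral>\<^sup>+\<omega>. (\<integral>\<^sup>+\<kappa>. h (\<kappa>, Y \<omega>) \<partial>distr M K X) * indicator A \<omega> \<partial>M)"
proof -
  \<comment> \<open>\<open>Q\<close> is \<open>M\<close> restricted to \<open>A\<close>. Its mass is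
    the probability of \<open>A\<close>, so it is finite but in general not a probability
    measure.\<close>
  define Q where "Q = density M (indicator A)"
  have sets_Q[measurable_cong]: "sets Q = sets M" by (simp add: Q_def)
  have Q_mass: "emeasure Q C = emeasure M (C \<inter> A)" if "C \<in> sets M" for C
    using that by (simp add: Q_def emeasure_density Int_commute flip: indicator_inter_arith)
  have space_Q: "space Q = space M" by (simp add: Q_def)
  interpret Q: finite_measure Q
    by (rule finite_measureI) (simp add: Q_mass space_Q)
  interpret X: prob_space "distr M K X" by (rule prob_space_distr) simp
  interpret Y: finite_measure "distr Q L Y"
    by (rule Q.finite_measure_distr) simp
  have "distr M K X \<Otimes>\<^sub>M distr Q L Y = distr Q (K \<Otimes>\<^sub>M L) (\<lambda>\<omega>. (X \<omega>, Y \<omega>))"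
  proof (rule pair_measure_eqI)
    fix B C assume "B \<in> sets (distr M K X)" "C \<in> sets (distr Q L Y)"
    then have [measurable]: "B \<in> sets K" "C \<in> sets L" by auto
    have YA: "Y -` C \<inter> space M \<inter> A = Y -` C \<inter> A" using sets.sets_into_space[OF assms(3)] by auto
    have XYA: "(\<lambda>\<omega>. (X \<omega>, Y \<omega>)) -` (B \<times> C) \<inter> space M \<inter> A = (X -` B \<inter> space M) \<inter> (Y -` C \<inter> A)"
      using sets.sets_into_space[OF assms(3)] by auto
    have [measurable]: "Y -` C \<inter> A \<in> sets M" by (subst YA[symmetric]) simp
    show "emeasure (distr M K X) B * emeasure (distr Q L Y) C
        = emeasure (distr Q (K \<Otimes>\<^sub>M L) (\<lambda>\<omega>. (X \<omega>, Y \<omega>))) (B \<times> C)"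
      by (simp add: emeasure_distr space_Q Q_mass YA XYA emeasure_eq_measure indep ennreal_mult'')
  qed (auto intro: X.sigma_finite_measure_axioms Y.sigma_finite_measure_axioms)
  note eq = this
  interpret XY: pair_sigma_finite "distr M K X" "distr Q L Y" ..
  have "(\<integral>\<^sup>+\<omega>. h (X \<omega>, Y \<omega>) * indicator A \<omega> \<partial>M) = (\<integral>\<^sup>+\<omega>. h (X \<omega>, Y \<omega>) \<partial>Q)"
    unfolding Q_def by (subst nn_integral_density) (auto simp: mult.commute)
  also have "\<dots> = (\<integral>\<^sup>+q. h q \<partial>(distr M K X \<Otimes>\<^sub>M distr Q L Y))"
    unfolding eq by (subst nn_integral_distr) auto
  also have "\<dots> = (\<integral>\<^sup>+y. (\<integral>\<^sup>+\<kappa>. h (\<kappa>, y) \<partial>distr M K X) \<partial>distr Q L Y)"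
    by (rule XY.nn_integral_snd[symmetric]) simp
  also have "\<dots> = (\<integral>\<^sup>+\<omega>. (\<integral>\<^sup>+\<kappa>. h (\<kappa>, Y \<omega>) \<partial>distr M K X) \<partial>Q)"
    by (subst nn_integral_distr) auto
  also have "\<dots> = (\<integral>\<^sup>+\<omega>. (\<integral>\<^sup>+\<kappa>. h (\<kappa>, Y \<omega>) \<partial>distr M K X) * indicator A \<omega> \<partial>M)"
    unfolding Q_def by (subst nn_integral_density) (auto simp: mult.commute)
  finally show ?thesis .
qed

text \<open>In a complete space every subset of a null set is measurable, so altering a function on
  a null set is harmless. This serves iterates that obey their recursion only almost surely.\<close>

lemma (in complete_measure) borel_measurable_AE_eq:
  fixes f g :: "'a \<Rightarrow> 'b::topological_space"
  assumes f[measurable]: "f \<in> borel_measurable M" and ae: "AE x in M. g x = f x"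
  shows "g \<in> borel_measurable M"
proof (rule measurableI)
  obtain N where N: "{x\<in>space M. g x \<noteq> f x} \<subseteq> N" "N \<in> null_sets M"
    using ae by (auto simp: eventually_ae_filter)
  fix B :: "'b set" assume [measurable]: "B \<in> sets borel"
  have [measurable]: "N \<in> sets M" using N(2) by auto
  have "g -` B \<inter> N \<inter> space M \<in> sets M"
    using N(2) by (intro complete[of _ N]) auto
  moreover have "f -` B \<inter> space M - N \<in> sets M" by measurable
  moreover have "g -` B \<inter> space M = (f -` B \<inter> space M - N) \<union> (g -` B \<inter> N \<inter> space M)"
    using N(1) by auto
  ultimately show "g -` B \<inter> space M \<in> sets M" by auto
qed simp

text \<open>Along the line through \<open>x\<close> and \<open>y\<close> this is the tangent
  inequality for a convex function of one real variable.\<close>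

lemma convex_on_GDERIV_above_tangent:
  fixes f :: "'h::real_inner \<Rightarrow> real"
  assumes "convex_on UNIV f" "GDERIV f x :> D"
  shows "f x + inner D (y - x) \<le> f y"
proof -
  define g where "g t = f (x + t *\<^sub>R (y - x))" for t
  have "convex_on UNIV g"
  proof (rule convex_onI)
    fix t a b :: real assume t: "0 < t" "t < 1"
    have "x + ((1 - t) *\<^sub>R a + t *\<^sub>R b) *\<^sub>R (y - x)
        = (1 - t) *\<^sub>R (x + a *\<^sub>R (y - x)) + t *\<^sub>R (x + b *\<^sub>R (y - x))"
      by (simp add: algebra_simps)
    then show "g ((1 - t) *\<^sub>R a + t *\<^sub>R b) \<le> (1 - t) * g a + t * g b"
      unfolding g_def using convex_onD[OF assms(1)] t by simp
  qed simp
  moreover have "(g has_field_derivative inner D (y - x)) (at 0)"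
  proof -
    have "(f has_derivative (\<lambda>h. inner h D)) (at (x + 0 *\<^sub>R (y - x)))"
      using assms(2) by (simp add: gderiv_def)
    then have "(g has_derivative (\<lambda>h. inner (h *\<^sub>R (y - x)) D)) (at 0)"
      unfolding g_def by (rule has_derivative_compose[rotated]) (auto intro!: derivative_eq_intros)
    moreover have "(\<lambda>h. inner (h *\<^sub>R (y - x)) D) = (*) (inner D (y - x))"
      by (auto simp: inner_commute)
    ultimately show ?thesis by (simp add: has_field_derivative_def)
  qed
  ultimately have "g 1 - g 0 \<ge> inner D (y - x) * (1 - 0)"
    by (intro convex_on_imp_above_tangent[where A = UNIV]) auto
  then show ?thesis by (simp add: g_def)
qed

subsection \<open>Estimates for one gradient step\<close>

text \<open>\<open>\<sigma>\<close> will be \<open>\<psi> (norm zs)\<close>; the Lipschitz property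
  carries this second moment bound from the minimizer \<open>zs\<close> to all other points.\<close>

locale convex_stochastic_oracle = prob_space M for M :: "'w measure" +
  fixes K :: "'k measure" and \<beta> \<sigma> :: real
    and f :: "'k \<Rightarrow> 'h::{real_inner, complete_space, second_countable_topology} \<Rightarrow> real"
    and k :: "'w \<Rightarrow> 'k" and zs :: 'h
  assumes beta: "0 < \<beta>" and sigma: "0 \<le> \<sigma>"
    and convex: "\<kappa> \<in> space K \<Longrightarrow> convex_on UNIV (f \<kappa>)"
    and differentiable: "\<kappa> \<in> space K \<Longrightarrow> f \<kappa> differentiable (at z)"
    and lipschitz: "\<kappa> \<in> space K \<Longrightarrow> \<beta>-lipschitz_on UNIV (grad (f \<kappa>))"
    and f_measurable: "(\<lambda>(\<kappa>, z). f \<kappa> z) \<in> borel_measurable (K \<Otimes>\<^sub>M borel)"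
    and grad_measurable: "(\<lambda>(\<kappa>, z). grad (f \<kappa>) z) \<in> borel_measurable (K \<Otimes>\<^sub>M borel)"
    and k_rv[measurable]: "k \<in> measurable M K"
    and f_integrable: "integrable M (\<lambda>\<omega>. f (k \<omega>) z)"
    and minimizer: "(\<integral>\<omega>. f (k \<omega>) zs \<partial>M) \<le> (\<integral>\<omega>. f (k \<omega>) z \<partial>M)"
    and sigma_bound: "(\<integral>\<^sup>+\<omega>. ennreal ((norm (grad (f (k \<omega>)) zs))\<^sup>2) \<partial>M) \<le> ennreal \<sigma>"
begin

abbreviation G :: "'k \<Rightarrow> 'h \<Rightarrow> 'h" where "G \<kappa> \<equiv> grad (f \<kappa>)"

definition gap :: "'h \<Rightarrow> real" where
  "gap z = (\<integral>\<omega>. f (k \<omega>) z \<partial>M) - (\<integral>\<omega>. f (k \<omega>) zs \<partial>M)"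

text \<open>The factors 2 come from (a + b)^2 \<le> 2 a^2 + 2 b^2, applied to the gradient at
  \<open>zs\<close> and a Lipschitz increment.\<close>

definition grad_bound :: "'h \<Rightarrow> real" where
  "grad_bound z = 2 * \<beta>\<^sup>2 * (norm (z - zs))\<^sup>2 + 2 * \<sigma>"

lemma f_measurable2[measurable (raw)]:
  assumes [measurable]: "u \<in> measurable N K" "v \<in> borel_measurable N"
  shows "(\<lambda>\<omega>. f (u \<omega>) (v \<omega>)) \<in> borel_measurable N"
  using measurable_compose[OF _ f_measurable, of "\<lambda>\<omega>. (u \<omega>, v \<omega>)" N] by simp

lemma G_measurable2[measurable (raw)]:
  assumes [measurable]: "u \<in> measurable N K" "v \<in> borel_measurable N"
  shows "(\<lambda>\<omega>. G (u \<omega>) (v \<omega>)) \<in> borel_measurable N"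
  using measurable_compose[OF _ grad_measurable, of "\<lambda>\<omega>. (u \<omega>, v \<omega>)" N] by simp

lemma k_space: "\<omega> \<in> space M \<Longrightarrow> k \<omega> \<in> space K"
  using k_rv by (rule measurable_space)

lemma gap_measurable[measurable]: "gap \<in> borel_measurable borel"
  unfolding gap_def by measurable

lemma gap_nonneg: "0 \<le> gap z"
  using minimizer by (simp add: gap_def)

lemma grad_bound_nonneg: "0 \<le> grad_bound z"
  using sigma by (simp add: grad_bound_def)

lemma tangent_le: "\<kappa> \<in> space K \<Longrightarrow> f \<kappa> z + inner (G \<kappa> z) (y - z) \<le> f \<kappa> y"
  using convex differentiable by (intro convex_on_GDERIV_above_tangent GDERIV_grad)

text \<open>The tangent inequality at \<open>y\<close> bounds \<open>f \<kappa> y\<close> with the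
  gradient at \<open>y\<close>; exchanging it for the gradient at \<open>z\<close> costs the
  quadratic term. The constant is \<open>\<beta>\<close> instead of the sharp
  \<open>\<beta> / 2\<close>, and no integration along the segment is required.\<close>

lemma descent:
  assumes "\<kappa> \<in> space K"
  shows "f \<kappa> y \<le> f \<kappa> z + inner (G \<kappa> z) (y - z) + \<beta> * (norm (y - z))\<^sup>2"
proof -
  have "f \<kappa> y + inner (G \<kappa> y) (z - y) \<le> f \<kappa> z"
    using assms by (rule tangent_le)
  then have "f \<kappa> y \<le> f \<kappa> z + inner (G \<kappa> z) (y - z) + inner (G \<kappa> y - G \<kappa> z) (y - z)"
    by (simp add: inner_diff_left inner_diff_right)
  moreover have "inner (G \<kappa> y - G \<kappa> z) (y - z) \<le> norm (G \<kappa> y - G \<kappa> z) * norm (y - z)"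
    by (rule norm_cauchy_schwarz)
  moreover have "\<dots> \<le> \<beta> * norm (y - z) * norm (y - z)"
    using lipschitz_onD[OF lipschitz[OF assms], of y z] by (intro mult_right_mono) (auto simp: dist_norm)
  ultimately show ?thesis by (simp add: power2_eq_square)
qed

lemma G_square_le:
  assumes "\<kappa> \<in> space K"
  shows "(norm (G \<kappa> z))\<^sup>2 \<le> 2 * \<beta>\<^sup>2 * (norm (z - zs))\<^sup>2 + 2 * (norm (G \<kappa> zs))\<^sup>2"
proof -
  have "norm (G \<kappa> z) \<le> norm (G \<kappa> z - G \<kappa> zs) + norm (G \<kappa> zs)"
    using norm_triangle_ineq[of "G \<kappa> z - G \<kappa> zs" "G \<kappa> zs"] by simp
  also have "norm (G \<kappa> z - G \<kappa> zs) \<le> \<beta> * norm (z - zs)"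
    using lipschitz_onD[OF lipschitz[OF assms], of z zs] by (auto simp: dist_norm)
  finally have "(norm (G \<kappa> z))\<^sup>2 \<le> (\<beta> * norm (z - zs) + norm (G \<kappa> zs))\<^sup>2"
    by (intro power_mono) auto
  moreover have "0 \<le> (\<beta> * norm (z - zs) - norm (G \<kappa> zs))\<^sup>2" by simp
  ultimately show ?thesis by (simp add: power2_eq_square algebra_simps)
qed

lemma G_square_integrable: "integrable M (\<lambda>\<omega>. (norm (G (k \<omega>) z))\<^sup>2)"
  and G_square_integral_le: "(\<integral>\<omega>. (norm (G (k \<omega>) z))\<^sup>2 \<partial>M) \<le> grad_bound z"
proof -
  have zs: "integrable M (\<lambda>\<omega>. (norm (G (k \<omega>) zs))\<^sup>2)"
    using sigma_bound by (intro integrableI_bounded) (auto intro: le_less_trans)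
  then have "(\<integral>\<omega>. (norm (G (k \<omega>) zs))\<^sup>2 \<partial>M) \<le> \<sigma>"
    using sigma_bound sigma by (subst (asm) nn_integral_eq_integral) (auto simp: ennreal_le_iff)
  then have le: "(\<integral>\<omega>. 2 * \<beta>\<^sup>2 * (norm (z - zs))\<^sup>2 + 2 * (norm (G (k \<omega>) zs))\<^sup>2 \<partial>M) \<le> grad_bound z"
    using zs by (simp add: grad_bound_def prob_space)
  show *: "integrable M (\<lambda>\<omega>. (norm (G (k \<omega>) z))\<^sup>2)"
    by (rule Bochner_Integration.integrable_bound[where f = "\<lambda>\<omega>. 2 * \<beta>\<^sup>2 * (norm (z - zs))\<^sup>2 + 2 * (norm (G (k \<omega>) zs))\<^sup>2"])
      (use zs G_square_le k_space in \<open>auto intro!: AE_I2\<close>)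
  have "(\<integral>\<omega>. (norm (G (k \<omega>) z))\<^sup>2 \<partial>M) \<le> (\<integral>\<omega>. 2 * \<beta>\<^sup>2 * (norm (z - zs))\<^sup>2 + 2 * (norm (G (k \<omega>) zs))\<^sup>2 \<partial>M)"
    using zs * G_square_le k_space by (intro integral_mono) auto
  with le show "(\<integral>\<omega>. (norm (G (k \<omega>) z))\<^sup>2 \<partial>M) \<le> grad_bound z" by simp
qed

lemma G_norm_integrable: "integrable M (\<lambda>\<omega>. norm (G (k \<omega>) z))"
proof (rule Bochner_Integration.integrable_bound)
  show "integrable M (\<lambda>\<omega>. 1 + (norm (G (k \<omega>) z))\<^sup>2)"
    using G_square_integrable by simp
  have "t \<le> 1 + t\<^sup>2" for t :: real
    using zero_le_power2[of "t - 1 / 2"] by (simp add: power2_eq_square algebra_simps)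
  then show "AE \<omega> in M. norm (norm (G (k \<omega>) z)) \<le> norm (1 + (norm (G (k \<omega>) z))\<^sup>2)"
    by simp
qed simp

lemma G_inner_integrable: "integrable M (\<lambda>\<omega>. inner (G (k \<omega>) z) h)"
proof (rule Bochner_Integration.integrable_bound)
  show "integrable M (\<lambda>\<omega>. norm (G (k \<omega>) z) * norm h)"
    using G_norm_integrable by simp
qed (auto intro: Cauchy_Schwarz_ineq2)

text \<open>
  The mean gradient comes from the Riesz representation theorem rather than from a Bochner
  integral: the integrability criteria of the library require the sort \<open>banach\<close>, which a type
  variable of sort \<open>{real_inner, complete_space}\<close> does not have.
\<close>

lemma mean_gradient_exists: "\<exists>v. \<forall>h. (\<integral>\<omega>. inner (G (k \<omega>) z) h \<partial>M) = inner v h"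
proof -
  have "bounded_linear (\<lambda>h. \<integral>\<omega>. inner (G (k \<omega>) z) h \<partial>M)"
  proof (rule bounded_linear_intro)
    fix h
    have "\<bar>\<integral>\<omega>. inner (G (k \<omega>) z) h \<partial>M\<bar> \<le> (\<integral>\<omega>. \<bar>inner (G (k \<omega>) z) h\<bar> \<partial>M)"
      by (rule integral_abs_bound)
    also have "\<dots> \<le> (\<integral>\<omega>. norm (G (k \<omega>) z) * norm h \<partial>M)"
      using G_norm_integrable G_inner_integrable
      by (intro integral_mono) (auto intro: Cauchy_Schwarz_ineq2)
    finally show "norm (\<integral>\<omega>. inner (G (k \<omega>) z) h \<partial>M) \<le> norm h * (\<integral>\<omega>. norm (G (k \<omega>) z) \<partial>M)"
      by (simp add: mult.commute)
  qed (use G_inner_integrable in \<open>simp_all add: inner_add_right\<close>)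
  from riesz_representation_exists[OF this] show ?thesis by (simp add: inner_commute)
qed

text \<open>Averaging \<open>descent\<close> over the sample gives the same inequality for
  \<open>gap\<close>, with the mean gradient \<open>v\<close>. At a random step the linear term has
  mean \<open>- c * inner v v\<close>, which is dropped, and the quadratic term is controlled by
  \<open>grad_bound\<close>.\<close>

lemma gap_step_le:
  assumes "0 \<le> c"
  shows "(\<integral>\<^sup>+\<omega>. ennreal (gap (z - c *\<^sub>R G (k \<omega>) z)) \<partial>M) \<le> ennreal (gap z + \<beta> * c\<^sup>2 * grad_bound z)"
proof -
  obtain v where v: "(\<integral>\<omega>. inner (G (k \<omega>) z) h \<partial>M) = inner v h" for h
    using mean_gradient_exists by blast
  \<comment> \<open>\<open>u\<close> is the bound \<open>gap_le\<close> at the random point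
    \<open>z - c *\<^sub>R G (k \<omega>) z\<close>. It dominates the nonnegative
    \<open>gap\<close>, so its two kinds of integral agree.\<close>
  define u where "u \<omega> = gap z - c * inner (G (k \<omega>) z) v + \<beta> * c\<^sup>2 * (norm (G (k \<omega>) z))\<^sup>2" for \<omega>
  have gap_le: "gap y \<le> gap z + inner v (y - z) + \<beta> * (norm (y - z))\<^sup>2" for y
  proof -
    have "(\<integral>\<omega>. f (k \<omega>) y \<partial>M) \<le> (\<integral>\<omega>. f (k \<omega>) z + inner (G (k \<omega>) z) (y - z) + \<beta> * (norm (y - z))\<^sup>2 \<partial>M)"
      using f_integrable G_inner_integrable descent k_space by (intro integral_mono) auto
    also have "\<dots> = (\<integral>\<omega>. f (k \<omega>) z \<partial>M) + inner v (y - z) + \<beta> * (norm (y - z))\<^sup>2"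
      using f_integrable G_inner_integrable by (simp add: v prob_space)
    finally show ?thesis by (simp add: gap_def)
  qed
  have gap_u: "gap (z - c *\<^sub>R G (k \<omega>) z) \<le> u \<omega>" for \<omega>
    using gap_le[of "z - c *\<^sub>R G (k \<omega>) z"]
    by (simp add: u_def power_mult_distrib inner_commute mult.assoc)
  have u: "integrable M u" unfolding u_def
    using G_inner_integrable G_square_integrable by simp
  have "(\<integral>\<omega>. u \<omega> \<partial>M) = gap z - c * inner v v + \<beta> * c\<^sup>2 * (\<integral>\<omega>. (norm (G (k \<omega>) z))\<^sup>2 \<partial>M)"
    unfolding u_def using G_inner_integrable G_square_integrable by (simp add: v prob_space)
  also have "\<dots> \<le> gap z + \<beta> * c\<^sup>2 * grad_bound z"
  proof -
    have "\<beta> * c\<^sup>2 * (\<integral>\<omega>. (norm (G (k \<omega>) z))\<^sup>2 \<partial>M) \<le> \<beta> * c\<^sup>2 * grad_bound z"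
      using beta by (intro mult_left_mono G_square_integral_le) simp
    moreover have "0 \<le> c * inner v v" using assms by simp
    ultimately show ?thesis by linarith
  qed
  finally have "(\<integral>\<omega>. u \<omega> \<partial>M) \<le> gap z + \<beta> * c\<^sup>2 * grad_bound z" .
  moreover have "(\<integral>\<^sup>+\<omega>. ennreal (gap (z - c *\<^sub>R G (k \<omega>) z)) \<partial>M) \<le> (\<integral>\<^sup>+\<omega>. ennreal (u \<omega>) \<partial>M)"
    by (intro nn_integral_mono ennreal_leI gap_u)
  moreover have "(\<integral>\<^sup>+\<omega>. ennreal (u \<omega>) \<partial>M) = ennreal (\<integral>\<omega>. u \<omega> \<partial>M)"
    using gap_u gap_nonneg by (intro nn_integral_eq_integral u AE_I2) (metis order_trans)
  ultimately show ?thesis by (metis ennreal_leI order_trans)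
qed

text \<open>Expand the square: by the tangent inequality the cross term has mean at most
  \<open>- 2 * c * gap z\<close>. It is moved to the left because \<open>ennreal\<close> has no
  negative values.\<close>

lemma distance_step_le:
  assumes "0 \<le> c"
  shows "(\<integral>\<^sup>+\<omega>. ennreal ((norm (z - c *\<^sub>R G (k \<omega>) z - zs))\<^sup>2) \<partial>M) + ennreal (2 * c * gap z)
    \<le> ennreal ((norm (z - zs))\<^sup>2 + c\<^sup>2 * grad_bound z)"
proof -
  define u where "u \<omega> = (norm (z - zs))\<^sup>2 + 2 * c * inner (G (k \<omega>) z) (zs - z) + c\<^sup>2 * (norm (G (k \<omega>) z))\<^sup>2" for \<omega>
  have eq: "(norm (z - c *\<^sub>R G (k \<omega>) z - zs))\<^sup>2 = u \<omega>" for \<omega>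
    unfolding u_def power2_norm_eq_inner
    by (simp add: inner_diff_left inner_diff_right inner_commute power2_eq_square algebra_simps)
  have u: "integrable M u" unfolding u_def
    using G_inner_integrable G_square_integrable by simp
  have "(\<integral>\<omega>. inner (G (k \<omega>) z) (zs - z) \<partial>M) \<le> (\<integral>\<omega>. f (k \<omega>) zs - f (k \<omega>) z \<partial>M)"
    using f_integrable G_inner_integrable tangent_le[OF k_space, of _ z zs]
    by (intro integral_mono) (auto simp: algebra_simps)
  also have "\<dots> = - gap z" using f_integrable by (simp add: gap_def)
  finally have "2 * c * (\<integral>\<omega>. inner (G (k \<omega>) z) (zs - z) \<partial>M) \<le> 2 * c * (- gap z)"
    using assms by (intro mult_left_mono) auto
  moreover have "(\<integral>\<omega>. u \<omega> \<partial>M) = (norm (z - zs))\<^sup>2 + 2 * c * (\<integral>\<omega>. inner (G (k \<omega>) z) (zs - z) \<partial>M)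
      + c\<^sup>2 * (\<integral>\<omega>. (norm (G (k \<omega>) z))\<^sup>2 \<partial>M)"
    unfolding u_def using G_inner_integrable G_square_integrable by (simp add: prob_space)
  moreover have "c\<^sup>2 * (\<integral>\<omega>. (norm (G (k \<omega>) z))\<^sup>2 \<partial>M) \<le> c\<^sup>2 * grad_bound z"
    by (intro mult_left_mono G_square_integral_le) simp
  ultimately have le: "(\<integral>\<omega>. u \<omega> \<partial>M) + 2 * c * gap z \<le> (norm (z - zs))\<^sup>2 + c\<^sup>2 * grad_bound z"
    by simp
  have u_nonneg: "0 \<le> u \<omega>" for \<omega> by (simp flip: eq)
  have "(\<integral>\<^sup>+\<omega>. ennreal (u \<omega>) \<partial>M) = ennreal (\<integral>\<omega>. u \<omega> \<partial>M)"
    by (intro nn_integral_eq_integral u AE_I2 u_nonneg)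
  then have "(\<integral>\<^sup>+\<omega>. ennreal (u \<omega>) \<partial>M) + ennreal (2 * c * gap z) = ennreal ((\<integral>\<omega>. u \<omega> \<partial>M) + 2 * c * gap z)"
    using u_nonneg assms gap_nonneg[of z] by (simp add: ennreal_plus integral_nonneg)
  then show ?thesis using le by (simp add: eq ennreal_leI)
qed

end

subsection \<open>Convergence of the weighted gap\<close>

text \<open>A discrete Gronwall argument: with \<open>t n = q n + r n\<close>, the quantity
  \<open>a n + 1\<close> grows by at most the factor \<open>1 + t n \<le> exp (t n)\<close>, so
  \<open>a\<close> is bounded. Telescoping with that bound controls the partial sums of
  \<open>b\<close>.\<close>

lemma perturbed_recursion:
  fixes a b q r :: "nat \<Rightarrow> real"
  assumes nonneg: "\<And>n. 0 \<le> a n" "\<And>n. 0 \<le> b n" "\<And>n. 0 \<le> q n" "\<And>n. 0 \<le> r n"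
    and summable: "summable q" "summable r"
    and rec: "\<And>n. a (Suc n) + b n \<le> (1 + q n) * a n + r n"
  shows "\<exists>R. \<forall>n. a n \<le> R" and "summable b"
proof -
  define t where "t n = q n + r n" for n
  have t: "summable t" "0 \<le> t n" for n
    using nonneg summable by (auto simp: t_def[abs_def] intro: summable_add)
  define R where "R = (a 0 + 1) * exp (suminf t)"
  have rec': "a (Suc n) + b n \<le> a n + t n * (a n + 1)" for n
  proof -
    have "0 \<le> r n * a n" using nonneg by simp
    then show ?thesis using rec[of n] nonneg(3)[of n] by (simp add: t_def algebra_simps)
  qed
  have growth: "a n + 1 \<le> (a 0 + 1) * exp (sum t {..<n})" for n
  proof (induction n)
    case (Suc n)
    have "a (Suc n) + 1 \<le> (1 + t n) * (a n + 1)"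
      using rec'[of n] nonneg(2)[of n] by (simp add: algebra_simps)
    also have "\<dots> \<le> exp (t n) * (a n + 1)"
      using nonneg(1)[of n] by (intro mult_right_mono) auto
    also have "\<dots> \<le> exp (t n) * ((a 0 + 1) * exp (sum t {..<n}))"
      using Suc by (intro mult_left_mono) auto
    finally show ?case by (simp add: exp_add mult_ac)
  qed simp
  have "(a 0 + 1) * exp (sum t {..<n}) \<le> R" for n
    unfolding R_def using t nonneg(1)[of 0]
    by (intro mult_left_mono) (auto intro: sum_le_suminf)
  with growth have R: "a n + 1 \<le> R" for n by (rule order_trans)
  have "a n \<le> R" for n using R[of n] by simp
  then show "\<exists>R. \<forall>n. a n \<le> R" by blast
  have "0 \<le> R" using R[of 0] nonneg(1)[of 0] by simp
  have total: "a n + sum b {..<n} \<le> a 0 + R * sum t {..<n}" for n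
  proof (induction n)
    case (Suc n)
    have "t n * (a n + 1) \<le> R * t n"
      using mult_left_mono[OF R[of n] t(2)[of n]] by (simp add: mult.commute)
    with Suc rec'[of n] show ?case by (simp add: distrib_left)
  qed simp
  have total': "R * sum t {..<n} \<le> R * suminf t" for n
    using t \<open>0 \<le> R\<close> by (intro mult_left_mono sum_le_suminf) auto
  have "sum b {..<n} \<le> a 0 + R * suminf t" for n
    using total[of n] total'[of n] nonneg(1)[of n] by linarith
  with nonneg(2) show "summable b" by (rule summableI_nonneg_bounded)
qed

text \<open>
  A variant of the divergence of \<open>\<Sum> (s (n+1) - s n) / s n\<close>: these terms dominate the increments
  of \<open>ln (s n)\<close>.
\<close>

lemma ex_weighted_le_of_summable:
  fixes s \<gamma> d :: "nat \<Rightarrow> real"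
  assumes s: "filterlim s at_top sequentially" "\<And>n. 0 \<le> s n" "\<And>n. s (Suc n) - s n \<le> C * \<gamma> n"
    and C: "0 \<le> C" and \<gamma>: "\<And>n. 0 < \<gamma> n" and d: "\<And>n. 0 \<le> d n"
    and summable: "summable (\<lambda>n. \<gamma> n * d n)" and \<epsilon>: "0 < \<epsilon>"
  shows "\<exists>n\<ge>N. s n * d n \<le> \<epsilon>"
proof (rule ccontr)
  assume "\<not> (\<exists>n\<ge>N. s n * d n \<le> \<epsilon>)"
  \<comment> \<open>Hence \<open>1 / s n < d n / \<epsilon>\<close> from \<open>N\<close> on. The
    increments of \<open>ln (s n)\<close> are then dominated by a summable series, so
    \<open>ln (s n)\<close> stays bounded, although \<open>s\<close> tends to infinity.\<close>
  then have large: "\<epsilon> < s n * d n" if "n \<ge> N" for n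
    using that by (meson not_less)
  have pos: "0 < s n" if "n \<ge> N" for n
    using large[OF that] \<epsilon> s(2)[of n] by (cases "s n = 0") auto
  have inc: "ln (s (Suc n)) - ln (s n) \<le> C / \<epsilon> * (\<gamma> n * d n)" if "n \<ge> N" for n
  proof -
    have "ln (s (Suc n)) - ln (s n) = ln (s (Suc n) / s n)"
      using pos[of n] pos[of "Suc n"] that by (simp add: ln_div)
    also have "\<dots> \<le> s (Suc n) / s n - 1"
      using pos[of n] pos[of "Suc n"] that by (intro ln_le_minus_one) simp
    also have "\<dots> = (s (Suc n) - s n) / s n"
      using pos[OF that] by (simp add: field_simps)
    also have "\<dots> \<le> C * \<gamma> n / s n"
      using s(3) pos[OF that] by (intro divide_right_mono) auto
    also have "\<dots> \<le> C * \<gamma> n * (d n / \<epsilon>)"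
    proof -
      have "1 / s n \<le> d n / \<epsilon>"
        using large[OF that] pos[OF that] \<epsilon> by (simp add: field_simps)
      moreover have "0 \<le> C * \<gamma> n" using C \<gamma>[of n] by simp
      ultimately show ?thesis using mult_left_mono by fastforce
    qed
    finally show ?thesis by (simp add: mult_ac)
  qed
  \<comment> \<open>The sum starts at 0 rather than at \<open>N\<close>; the additional terms are
    nonnegative.\<close>
  have bound: "ln (s (N + m)) \<le> ln (s N) + C / \<epsilon> * (\<Sum>i<N + m. \<gamma> i * d i)" for m
  proof (induction m)
    case 0
    have "0 \<le> (\<Sum>i<N. \<gamma> i * d i)"
      using \<gamma> d by (intro sum_nonneg mult_nonneg_nonneg) (auto intro: less_imp_le)
    then show ?case using C \<epsilon> by simp
  next
    case (Suc m)
    then show ?case using inc[of "N + m"] by (simp add: distrib_left)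
  qed
  define T where "T = ln (s N) + C / \<epsilon> * (\<Sum>i. \<gamma> i * d i)"
  have T: "ln (s (N + m)) \<le> T" for m
  proof -
    have "(\<Sum>i<N + m. \<gamma> i * d i) \<le> (\<Sum>i. \<gamma> i * d i)"
      using \<gamma> d by (intro sum_le_suminf summable ballI mult_nonneg_nonneg) (auto intro: less_imp_le)
    then have "C / \<epsilon> * (\<Sum>i<N + m. \<gamma> i * d i) \<le> C / \<epsilon> * (\<Sum>i. \<gamma> i * d i)"
      using C \<epsilon> by (intro mult_left_mono) auto
    then show ?thesis using bound[of m] by (simp add: T_def)
  qed
  have "eventually (\<lambda>n. exp T < s n) sequentially"
    using s(1) by (auto simp: filterlim_at_top_dense)
  then obtain m where "m \<ge> N" "exp T < s m"
    unfolding eventually_sequentially by (meson le_cases order_refl)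
  moreover from T[of "m - N"] \<open>m \<ge> N\<close> have "ln (s m) \<le> T" by simp
  ultimately show False using pos[of m] by (metis exp_le_cancel_iff exp_ln not_less)
qed

section \<open>The iteration and its one-step conditional means\<close>

locale stochastic_gradient_descent = convex_stochastic_oracle +
  fixes x :: "nat \<Rightarrow> 'a \<Rightarrow> 'c" and \<gamma> :: "nat \<Rightarrow> real" and kk :: "nat \<Rightarrow> 'a \<Rightarrow> 'b"
  assumes x_measurable[measurable]: "x n \<in> borel_measurable M"
    and x0_L2: "integrable M (\<lambda>\<omega>. (norm (x 0 \<omega>))\<^sup>2)"
    and gamma_pos: "0 < \<gamma> n"
    and kk_rv[measurable]: "kk n \<in> measurable M K"
    and kk_copy: "distr M K (kk n) = distr M K k"
    and kk_indep: "indep_set {kk n -` A \<inter> space M | A. A \<in> sets K} (generated_events M x n)"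
    and step: "AE \<omega> in M. x (Suc n) \<omega> = x n \<omega> - \<gamma> n *\<^sub>R grad (f (kk n \<omega>)) (x n \<omega>)"
begin

lemma sigma_algebra_generated: "sigma_algebra (space M) (generated_events M x n)"
  unfolding generated_events_def by (rule sigma_algebra_sigma_sets) auto

lemma generated_events_Suc: "generated_events M x n \<subseteq> generated_events M x (Suc n)"
  unfolding generated_events_def by (rule sigma_sets_mono') (use le_SucI in blast)

lemma generated_events_sets: "generated_events M x n \<subseteq> sets M"
  unfolding generated_events_def by (rule sets.sigma_sets_subset) auto

lemma vimage_generated: "B \<in> sets borel \<Longrightarrow> x n -` B \<inter> space M \<in> generated_events M x n"
  unfolding generated_events_def by (rule sigma_sets.Basic) blast

lemma nn_integral_step:
  assumes [measurable]: "h \<in> borel_measurable borel" and A: "A \<in> generated_events M x n"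
  shows "(\<integral>\<^sup>+\<omega>. h (x (Suc n) \<omega>) * indicator A \<omega> \<partial>M)
    = (\<integral>\<^sup>+\<omega>. (\<integral>\<^sup>+\<omega>'. h (x n \<omega> - \<gamma> n *\<^sub>R G (k \<omega>') (x n \<omega>)) \<partial>M) * indicator A \<omega> \<partial>M)"
proof -
  have [measurable]: "A \<in> sets M" using A generated_events_sets by blast
  let ?h = "\<lambda>(\<kappa>, z). h (z - \<gamma> n *\<^sub>R G \<kappa> z)"
  have "(\<integral>\<^sup>+\<omega>. h (x (Suc n) \<omega>) * indicator A \<omega> \<partial>M)
      = (\<integral>\<^sup>+\<omega>. ?h (kk n \<omega>, x n \<omega>) * indicator A \<omega> \<partial>M)"
    using step[of n] by (intro nn_integral_cong_AE) (auto elim: eventually_mono)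
  also have "\<dots> = (\<integral>\<^sup>+\<omega>. (\<integral>\<^sup>+\<kappa>. ?h (\<kappa>, x n \<omega>) \<partial>distr M K (kk n)) * indicator A \<omega> \<partial>M)"
  proof (rule nn_integral_indep_freeze)
    fix B C assume B: "B \<in> sets K" and C: "C \<in> sets (borel :: 'c measure)"
    interpret sigma_algebra "space M" "generated_events M x n"
      by (rule sigma_algebra_generated)
    have "x n -` C \<inter> A = (x n -` C \<inter> space M) \<inter> A"
      using sets.sets_into_space[of A M] by auto
    also have "\<dots> \<in> generated_events M x n"
      using vimage_generated[OF C] A by (rule Int)
    finally have "x n -` C \<inter> A \<in> generated_events M x n" .
    then show "prob (kk n -` B \<inter> space M \<inter> (x n -` C \<inter> A))
        = prob (kk n -` B \<inter> space M) * prob (x n -` C \<inter> A)"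
      using B by (intro indep_setD[OF kk_indep]) auto
  qed measurable
  also have "\<dots> = (\<integral>\<^sup>+\<omega>. (\<integral>\<^sup>+\<omega>'. h (x n \<omega> - \<gamma> n *\<^sub>R G (k \<omega>') (x n \<omega>)) \<partial>M) * indicator A \<omega> \<partial>M)"
    unfolding kk_copy by (subst nn_integral_distr) simp_all
  finally show ?thesis .
qed

section \<open>Moments of the iterates\<close>

text \<open>Values in \<open>ennreal\<close> allow the recursion for the means to be proved before
  they are known to be finite.\<close>

definition mean_dist :: "nat \<Rightarrow> ennreal" where
  "mean_dist n = (\<integral>\<^sup>+\<omega>. ennreal ((norm (x n \<omega> - zs))\<^sup>2) \<partial>M)"

definition mean_gap :: "nat \<Rightarrow> ennreal" where
  "mean_gap n = (\<integral>\<^sup>+\<omega>. ennreal (gap (x n \<omega>)) \<partial>M)"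

lemma nn_integral_grad_bound: "(\<integral>\<^sup>+\<omega>. ennreal (grad_bound (x n \<omega>)) \<partial>M) = ennreal (2 * \<beta>\<^sup>2) * mean_dist n + ennreal (2 * \<sigma>)"
proof -
  have "(\<integral>\<^sup>+\<omega>. ennreal (grad_bound (x n \<omega>)) \<partial>M)
      = (\<integral>\<^sup>+\<omega>. ennreal (2 * \<beta>\<^sup>2) * ennreal ((norm (x n \<omega> - zs))\<^sup>2) + ennreal (2 * \<sigma>) \<partial>M)"
    using sigma by (intro nn_integral_cong) (simp add: grad_bound_def ennreal_plus ennreal_mult)
  then show ?thesis
    by (simp add: nn_integral_add nn_integral_cmult mean_dist_def emeasure_space_1)
qed

text \<open>\<open>distance_step_le\<close> is integrated over the law of \<open>x n\<close>, taking
  the whole space as the event in \<open>nn_integral_step\<close>.\<close>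

lemma distance_recursion:
  "mean_dist (Suc n) + ennreal (2 * \<gamma> n) * mean_gap n
    \<le> mean_dist n + ennreal ((\<gamma> n)\<^sup>2) * (ennreal (2 * \<beta>\<^sup>2) * mean_dist n + ennreal (2 * \<sigma>))"
proof -
  interpret sigma_algebra "space M" "generated_events M x n"
    by (rule sigma_algebra_generated)
  have [measurable]: "grad_bound \<in> borel_measurable borel" unfolding grad_bound_def by measurable
  have "mean_dist (Suc n) = (\<integral>\<^sup>+\<omega>. ennreal ((norm (x (Suc n) \<omega> - zs))\<^sup>2) * indicator (space M) \<omega> \<partial>M)"
    unfolding mean_dist_def by (intro nn_integral_cong) simp
  also have "\<dots> = (\<integral>\<^sup>+\<omega>. (\<integral>\<^sup>+\<omega>'. ennreal ((norm (x n \<omega> - \<gamma> n *\<^sub>R G (k \<omega>') (x n \<omega>) - zs))\<^sup>2) \<partial>M)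
      * indicator (space M) \<omega> \<partial>M)"
    by (rule nn_integral_step) auto
  also have "\<dots> = (\<integral>\<^sup>+\<omega>. (\<integral>\<^sup>+\<omega>'. ennreal ((norm (x n \<omega> - \<gamma> n *\<^sub>R G (k \<omega>') (x n \<omega>) - zs))\<^sup>2) \<partial>M) \<partial>M)"
    by (intro nn_integral_cong) simp
  finally have "mean_dist (Suc n) + ennreal (2 * \<gamma> n) * mean_gap n
      = (\<integral>\<^sup>+\<omega>. (\<integral>\<^sup>+\<omega>'. ennreal ((norm (x n \<omega> - \<gamma> n *\<^sub>R G (k \<omega>') (x n \<omega>) - zs))\<^sup>2) \<partial>M)
        + ennreal (2 * \<gamma> n * gap (x n \<omega>)) \<partial>M)"
    using gamma_pos[of n] gap_nonneg
    by (simp add: nn_integral_add mean_gap_def ennreal_mult nn_integral_cmult less_imp_le)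
  also have "\<dots> \<le> (\<integral>\<^sup>+\<omega>. ennreal ((norm (x n \<omega> - zs))\<^sup>2 + (\<gamma> n)\<^sup>2 * grad_bound (x n \<omega>)) \<partial>M)"
    using gamma_pos[of n] by (intro nn_integral_mono distance_step_le) simp
  also have "\<dots> = mean_dist n + ennreal ((\<gamma> n)\<^sup>2) * (\<integral>\<^sup>+\<omega>. ennreal (grad_bound (x n \<omega>)) \<partial>M)"
    using grad_bound_nonneg by (simp add: nn_integral_add mean_dist_def ennreal_mult nn_integral_cmult)
  finally show ?thesis by (simp add: nn_integral_grad_bound)
qed

lemma mean_dist_finite: "mean_dist n < \<infinity>"
proof (induction n)
  case 0
  have "ennreal ((norm (x 0 \<omega> - zs))\<^sup>2) \<le> ennreal (2 * (norm (x 0 \<omega>))\<^sup>2 + 2 * (norm zs)\<^sup>2)" for \<omega>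
  proof (rule ennreal_leI)
    have "(norm (x 0 \<omega> - zs))\<^sup>2 \<le> (norm (x 0 \<omega>) + norm zs)\<^sup>2"
      by (intro power_mono norm_triangle_ineq4) simp
    also have "\<dots> \<le> 2 * (norm (x 0 \<omega>))\<^sup>2 + 2 * (norm zs)\<^sup>2"
      using zero_le_power2[of "norm (x 0 \<omega>) - norm zs"] by (simp add: power2_eq_square algebra_simps)
    finally show "(norm (x 0 \<omega> - zs))\<^sup>2 \<le> 2 * (norm (x 0 \<omega>))\<^sup>2 + 2 * (norm zs)\<^sup>2" .
  qed
  then have "mean_dist 0 \<le> (\<integral>\<^sup>+\<omega>. ennreal (2 * (norm (x 0 \<omega>))\<^sup>2 + 2 * (norm zs)\<^sup>2) \<partial>M)"
    unfolding mean_dist_def by (intro nn_integral_mono)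
  also have "\<dots> = ennreal (\<integral>\<omega>. 2 * (norm (x 0 \<omega>))\<^sup>2 + 2 * (norm zs)\<^sup>2 \<partial>M)"
    using x0_L2 by (intro nn_integral_eq_integral) auto
  also have "\<dots> < \<infinity>" by simp
  finally show ?case .
next
  case (Suc n)
  then have "mean_dist n + ennreal ((\<gamma> n)\<^sup>2) * (ennreal (2 * \<beta>\<^sup>2) * mean_dist n + ennreal (2 * \<sigma>)) < \<infinity>"
    by (simp add: ennreal_mult_less_top)
  with distance_recursion[of n] have "mean_dist (Suc n) + ennreal (2 * \<gamma> n) * mean_gap n < \<infinity>"
    by (rule le_less_trans)
  then show ?case by simp
qed

text \<open>The recursion bounds \<open>2 * \<gamma> n\<close> times the mean gap by a finite
  quantity, and \<open>\<gamma> n\<close> is strictly positive.\<close>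

lemma mean_gap_finite: "mean_gap n < \<infinity>"
proof -
  have "mean_dist n + ennreal ((\<gamma> n)\<^sup>2) * (ennreal (2 * \<beta>\<^sup>2) * mean_dist n + ennreal (2 * \<sigma>)) < \<infinity>"
    using mean_dist_finite[of n] by (simp add: ennreal_mult_less_top)
  with distance_recursion[of n] have "mean_dist (Suc n) + ennreal (2 * \<gamma> n) * mean_gap n < \<infinity>"
    by (rule le_less_trans)
  then show ?thesis using gamma_pos[of n] by (auto simp: ennreal_mult_less_top ennreal_eq_0_iff not_le)
qed

text \<open>Once all means are finite, \<open>distance_recursion\<close> is an inequality between
  reals of the shape treated in \<open>perturbed_recursion\<close>, with \<open>q\<close> and
  \<open>r\<close> multiples of \<open>(\<gamma> n)\<^sup>2\<close>.\<close>

lemma moment_bounds: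
  assumes "summable (\<lambda>n. (\<gamma> n)\<^sup>2)"
  shows "\<exists>R. \<forall>n. enn2real (mean_dist n) \<le> R" and "summable (\<lambda>n. \<gamma> n * enn2real (mean_gap n))"
proof -
  have rec: "enn2real (mean_dist (Suc n)) + 2 * \<gamma> n * enn2real (mean_gap n)
      \<le> (1 + 2 * \<beta>\<^sup>2 * (\<gamma> n)\<^sup>2) * enn2real (mean_dist n) + 2 * \<sigma> * (\<gamma> n)\<^sup>2" for n
  proof -
    have a: "mean_dist m = ennreal (enn2real (mean_dist m))" for m using mean_dist_finite[of m] by simp
    have d: "mean_gap n = ennreal (enn2real (mean_gap n))" using mean_gap_finite[of n] by simp
    have "ennreal (enn2real (mean_dist (Suc n)) + 2 * \<gamma> n * enn2real (mean_gap n))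
        = mean_dist (Suc n) + ennreal (2 * \<gamma> n) * mean_gap n"
      using gamma_pos[of n] by (subst a, subst d) (simp add: ennreal_mult less_imp_le)
    also have "\<dots> \<le> mean_dist n + ennreal ((\<gamma> n)\<^sup>2) * (ennreal (2 * \<beta>\<^sup>2) * mean_dist n + ennreal (2 * \<sigma>))"
      by (rule distance_recursion)
    also have "\<dots> = ennreal (enn2real (mean_dist n) + (\<gamma> n)\<^sup>2 * (2 * \<beta>\<^sup>2 * enn2real (mean_dist n) + 2 * \<sigma>))"
      using sigma by (subst (1 2) a) (simp add: ennreal_mult)
    finally have "enn2real (mean_dist (Suc n)) + 2 * \<gamma> n * enn2real (mean_gap n)
        \<le> enn2real (mean_dist n) + (\<gamma> n)\<^sup>2 * (2 * \<beta>\<^sup>2 * enn2real (mean_dist n) + 2 * \<sigma>)"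
      using sigma by (subst (asm) ennreal_le_iff) simp_all
    then show ?thesis by (simp add: algebra_simps)
  qed
  note bounds = perturbed_recursion[of "\<lambda>n. enn2real (mean_dist n)" "\<lambda>n. 2 * \<gamma> n * enn2real (mean_gap n)"
      "\<lambda>n. 2 * \<beta>\<^sup>2 * (\<gamma> n)\<^sup>2" "\<lambda>n. 2 * \<sigma> * (\<gamma> n)\<^sup>2"]
  show "\<exists>R. \<forall>n. enn2real (mean_dist n) \<le> R"
    using assms sigma gamma_pos rec by (intro bounds) (simp_all add: less_imp_le)
  have "summable (\<lambda>n. 2 * \<gamma> n * enn2real (mean_gap n))"
    using assms sigma gamma_pos rec by (intro bounds) (simp_all add: less_imp_le)
  then have "summable (\<lambda>n. 1 / 2 * (2 * \<gamma> n * enn2real (mean_gap n)))" by (rule summable_mult)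
  then show "summable (\<lambda>n. \<gamma> n * enn2real (mean_gap n))" by simp
qed

theorem weighted_gap_tendsto_0:
  assumes s: "filterlim s at_top sequentially" "\<And>n. 0 \<le> s n" "\<And>n. s (Suc n) - s n \<le> C * \<gamma> n"
    and C: "0 \<le> C"
    and summable: "summable (\<lambda>n. (\<gamma> n)\<^sup>2)" "summable (\<lambda>n. s (Suc n) * (\<gamma> n)\<^sup>2)"
  shows "AE \<omega> in M. (\<lambda>n. s n * gap (x n \<omega>)) \<longlonglongrightarrow> 0"
proof -
  obtain R where R: "enn2real (mean_dist n) \<le> R" for n
    using moment_bounds(1)[OF summable(1)] by blast
  have "0 \<le> R" using R[of 0] by (rule order_trans[OF enn2real_nonneg])
  \<comment> \<open>The first term pays for the growth of the weight,
    \<open>s (Suc n) - s n \<le> C * \<gamma> n\<close>. The second is the error of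
    \<open>gap_step_le\<close> times the new weight, with \<open>mean_dist n\<close> replaced by its
    bound \<open>R\<close>.\<close>
  define e where "e n = C * (\<gamma> n * enn2real (mean_gap n))
    + \<beta> * (2 * \<beta>\<^sup>2 * R + 2 * \<sigma>) * (s (Suc n) * (\<gamma> n)\<^sup>2)" for n
  have d_eq: "mean_gap n = ennreal (enn2real (mean_gap n))" for n using mean_gap_finite[of n] by simp
  have [measurable]: "grad_bound \<in> borel_measurable borel" unfolding grad_bound_def by measurable
  show ?thesis
  proof (rule almost_supermartingale_tendsto_0[where \<F> = "generated_events M x" and e = e])
    show "sigma_algebra (space M) (generated_events M x n)"
      "generated_events M x n \<subseteq> generated_events M x (Suc n)"
      "generated_events M x n \<subseteq> sets M" for n
      by (fact sigma_algebra_generated generated_events_Suc generated_events_sets)+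
    show "(\<lambda>\<omega>. s n * gap (x n \<omega>)) \<in> borel_measurable M" for n by measurable
    show "0 \<le> s n * gap (x n \<omega>)" for n \<omega>
      using s(2) gap_nonneg by simp
    show "{\<omega>\<in>space M. s n * gap (x n \<omega>) < c} \<in> generated_events M x n" for n c
    proof -
      have "{z. s n * gap z < c} \<in> sets borel" by measurable
      from vimage_generated[OF this, of n] show ?thesis
        by (simp add: vimage_def Int_def conj_commute)
    qed
    show "0 \<le> e n" for n
      unfolding e_def using C s(2) gamma_pos[of n] beta sigma \<open>0 \<le> R\<close> by simp
    show "summable e"
      unfolding e_def using moment_bounds(2)[OF summable(1)] summable(2)
      by (intro summable_add summable_mult)
    show "\<exists>n\<ge>N. (\<integral>\<^sup>+\<omega>. ennreal (s n * gap (x n \<omega>)) \<partial>M) \<le> ennreal \<epsilon>" if "0 < \<epsilon>" for \<epsilon> N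
    proof -
      obtain n where n: "n \<ge> N" "s n * enn2real (mean_gap n) \<le> \<epsilon>"
        using ex_weighted_le_of_summable[OF s C gamma_pos enn2real_nonneg moment_bounds(2)[OF summable(1)] \<open>0 < \<epsilon>\<close>] by blast
      have "(\<integral>\<^sup>+\<omega>. ennreal (s n * gap (x n \<omega>)) \<partial>M) = ennreal (s n) * mean_gap n"
        using s(2) gap_nonneg by (simp add: ennreal_mult nn_integral_cmult mean_gap_def)
      also have "\<dots> = ennreal (s n * enn2real (mean_gap n))"
        using s(2) by (subst d_eq) (simp add: ennreal_mult)
      also have "\<dots> \<le> ennreal \<epsilon>" using n(2) by (rule ennreal_leI)
      finally show ?thesis using n(1) by blast
    qed
    fix n A assume A: "A \<in> generated_events M x n"
    then have [measurable]: "A \<in> sets M" using generated_events_sets by blast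
    let ?c = "s (Suc n) * (\<beta> * (\<gamma> n)\<^sup>2)"
    have "0 \<le> ?c" using s(2) beta by simp
    have "(\<integral>\<^sup>+\<omega>. ennreal (s (Suc n) * gap (x (Suc n) \<omega>)) * indicator A \<omega> \<partial>M)
        = (\<integral>\<^sup>+\<omega>. (\<integral>\<^sup>+\<omega>'. ennreal (s (Suc n) * gap (x n \<omega> - \<gamma> n *\<^sub>R G (k \<omega>') (x n \<omega>))) \<partial>M)
          * indicator A \<omega> \<partial>M)"
      using A by (intro nn_integral_step) measurable
    \<comment> \<open>Only the main term keeps the indicator. The errors are enlarged to the whole
      space, so that their integral does not depend on \<open>A\<close>.\<close>
    also have "\<dots> \<le> (\<integral>\<^sup>+\<omega>. ennreal (s n * gap (x n \<omega>)) * indicator A \<omega>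
        + (ennreal (C * \<gamma> n) * ennreal (gap (x n \<omega>)) + ennreal ?c * ennreal (grad_bound (x n \<omega>))) \<partial>M)"
    proof (rule nn_integral_mono)
      fix \<omega>
      let ?z = "x n \<omega>"
      have "(\<integral>\<^sup>+\<omega>'. ennreal (s (Suc n) * gap (?z - \<gamma> n *\<^sub>R G (k \<omega>') ?z)) \<partial>M)
          = ennreal (s (Suc n)) * (\<integral>\<^sup>+\<omega>'. ennreal (gap (?z - \<gamma> n *\<^sub>R G (k \<omega>') ?z)) \<partial>M)"
        using s(2) gap_nonneg by (simp add: ennreal_mult nn_integral_cmult)
      also have "\<dots> \<le> ennreal (s (Suc n)) * ennreal (gap ?z + \<beta> * (\<gamma> n)\<^sup>2 * grad_bound ?z)"
        using gamma_pos[of n] by (intro mult_left_mono gap_step_le) auto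
      also have "\<dots> = ennreal (s (Suc n) * gap ?z + ?c * grad_bound ?z)"
        using s(2) gap_nonneg grad_bound_nonneg beta
        by (subst ennreal_mult[symmetric]) (auto simp: distrib_left mult.assoc)
      also have "\<dots> \<le> ennreal (s n * gap ?z + (C * \<gamma> n * gap ?z + ?c * grad_bound ?z))"
      proof (rule ennreal_leI)
        have "s (Suc n) * gap ?z \<le> (s n + C * \<gamma> n) * gap ?z"
          using s(3)[of n] gap_nonneg by (intro mult_right_mono) auto
        then show "s (Suc n) * gap ?z + ?c * grad_bound ?z \<le> s n * gap ?z + (C * \<gamma> n * gap ?z + ?c * grad_bound ?z)"
          by (simp add: distrib_right)
      qed
      also have "\<dots> = ennreal (s n * gap ?z) + (ennreal (C * \<gamma> n) * ennreal (gap ?z) + ennreal ?c * ennreal (grad_bound ?z))"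
        using s(2) gap_nonneg[of ?z] grad_bound_nonneg[of ?z] C gamma_pos[of n] \<open>0 \<le> ?c\<close>
        by (simp add: ennreal_plus ennreal_mult)
      finally show "(\<integral>\<^sup>+\<omega>'. ennreal (s (Suc n) * gap (?z - \<gamma> n *\<^sub>R G (k \<omega>') ?z)) \<partial>M) * indicator A \<omega>
          \<le> ennreal (s n * gap ?z) * indicator A \<omega>
            + (ennreal (C * \<gamma> n) * ennreal (gap ?z) + ennreal ?c * ennreal (grad_bound ?z))"
        by (cases "\<omega> \<in> A") auto
    qed
    also have "\<dots> = (\<integral>\<^sup>+\<omega>. ennreal (s n * gap (x n \<omega>)) * indicator A \<omega> \<partial>M)
        + (ennreal (C * \<gamma> n) * mean_gap n + ennreal ?c * (ennreal (2 * \<beta>\<^sup>2) * mean_dist n + ennreal (2 * \<sigma>)))"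
      unfolding nn_integral_grad_bound[symmetric] mean_gap_def
      by (simp add: nn_integral_add nn_integral_cmult)
    also have "\<dots> \<le> (\<integral>\<^sup>+\<omega>. ennreal (s n * gap (x n \<omega>)) * indicator A \<omega> \<partial>M) + ennreal (e n)"
    proof (rule add_left_mono)
      have "mean_dist n \<le> ennreal R"
        using R[of n] mean_dist_finite[of n] by (metis ennreal_enn2real ennreal_leI infinity_ennreal_def)
      then have "ennreal (C * \<gamma> n) * mean_gap n + ennreal ?c * (ennreal (2 * \<beta>\<^sup>2) * mean_dist n + ennreal (2 * \<sigma>))
          \<le> ennreal (C * \<gamma> n) * ennreal (enn2real (mean_gap n))
            + ennreal ?c * (ennreal (2 * \<beta>\<^sup>2) * ennreal R + ennreal (2 * \<sigma>))"
        by (intro add_mono mult_left_mono) (auto simp flip: d_eq)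
      also have "\<dots> = ennreal (C * \<gamma> n * enn2real (mean_gap n) + ?c * (2 * \<beta>\<^sup>2 * R + 2 * \<sigma>))"
        using C gamma_pos[of n] \<open>0 \<le> ?c\<close> \<open>0 \<le> R\<close> sigma by (simp add: ennreal_plus ennreal_mult)
      also have "C * \<gamma> n * enn2real (mean_gap n) + ?c * (2 * \<beta>\<^sup>2 * R + 2 * \<sigma>) = e n"
        by (simp add: e_def mult_ac)
      finally show "ennreal (C * \<gamma> n) * mean_gap n + ennreal ?c * (ennreal (2 * \<beta>\<^sup>2) * mean_dist n + ennreal (2 * \<sigma>))
          \<le> ennreal (e n)" .
    qed
    finally show "(\<integral>\<^sup>+\<omega>. ennreal (s (Suc n) * gap (x (Suc n) \<omega>)) * indicator A \<omega> \<partial>M)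
        \<le> (\<integral>\<^sup>+\<omega>. ennreal (s n * gap (x n \<omega>)) * indicator A \<omega> \<partial>M) + ennreal (e n)" .
  qed
qed

end

subsection \<open>Rates\<close>

lemma Suc_powr_square: "(real (n + 1) powr (- p))\<^sup>2 = real (Suc n) powr (- 2 * p)"
  by (simp add: powr_powr mult.commute flip: powr_numeral)

lemma summable_Suc_powr: "q < - 1 \<Longrightarrow> summable (\<lambda>n. real (Suc n) powr q)"
  by (subst summable_Suc_iff) (simp add: summable_real_powr_iff)

text \<open>Since \<open>ln y \<le> 2 * y powr (1 / 2)\<close> for positive \<open>y\<close>, the
  terms are dominated by those with exponent -3/2.\<close>

lemma summable_ln_Suc_mult_powr: "summable (\<lambda>n. ln (real (Suc n)) * real (Suc n) powr (- 2))"
proof (rule summable_comparison_test)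
  show "summable (\<lambda>n. 2 * real (Suc n) powr (- 3 / 2))"
    by (intro summable_mult summable_Suc_powr) simp
  have "norm (ln (real (Suc n)) * real (Suc n) powr (- 2)) \<le> 2 * real (Suc n) powr (- 3 / 2)" for n
  proof -
    have "ln (real (Suc n)) \<le> real (Suc n) powr (1 / 2) / (1 / 2)"
      by (intro ln_powr_bound) auto
    then have "ln (real (Suc n)) * real (Suc n) powr (- 2)
        \<le> 2 * real (Suc n) powr (1 / 2) * real (Suc n) powr (- 2)"
      by (intro mult_right_mono) auto
    also have "\<dots> = 2 * real (Suc n) powr (- 3 / 2)"
      by (simp flip: powr_add)
    finally show ?thesis by simp
  qed
  then show "\<exists>N. \<forall>n\<ge>N. norm (ln (real (Suc n)) * real (Suc n) powr (- 2)) \<le> 2 * real (Suc n) powr (- 3 / 2)"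
    by blast
qed

text \<open>Write y^(1-p) as y times y^(-p). For positive \<open>n\<close>, replacing n^(-p) in the
  subtracted term by the smaller (n+1)^(-p) leaves exactly (n+1)^(-p).\<close>

lemma powr_increment_le: "real (Suc n) powr (1 - p) - real n powr (1 - p) \<le> real (n + 1) powr (- p)"
  if "0 < p"
proof -
  have split: "y powr (1 - p) = y * y powr (- p)" if "0 \<le> y" for y :: real
    using that by (cases "y = 0") (auto simp: powr_diff powr_minus_divide)
  have "real n * real (Suc n) powr (- p) \<le> real n * real n powr (- p)"
    using \<open>0 < p\<close> by (cases "n = 0") (auto intro!: mult_left_mono powr_mono2')
  then show ?thesis by (simp add: split distrib_right add.commute)
qed

text \<open>For positive \<open>n\<close> the increment is at most \<open>1 / n\<close>, and the
  factor 2 pays for passing to \<open>1 / (n + 1)\<close>. At \<open>n = 0\<close> the convention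
  \<open>ln 0 = 0\<close> makes the left side vanish.\<close>

lemma ln_increment_le: "ln (real (Suc n)) - ln (real n) \<le> 2 * real (n + 1) powr (- 1)"
proof (cases "n = 0")
  case False
  then have "ln (real (Suc n)) - ln (real n) = ln (real (Suc n) / real n)"
    by (simp add: ln_div)
  also have "\<dots> \<le> real (Suc n) / real n - 1"
    using False by (intro ln_le_minus_one) simp
  also have "\<dots> \<le> 2 / real (n + 1)" using False by (simp add: field_simps)
  finally show ?thesis by (simp add: powr_minus_divide)
qed simp

lemma smallo_inverse_of_tendsto_mult:
  fixes s g :: "nat \<Rightarrow> real"
  assumes "(\<lambda>n. s n * g n) \<longlonglongrightarrow> 0" "filterlim s at_top sequentially"
  shows "g \<in> o(\<lambda>n. 1 / s n)"
proof (rule smalloI_tendsto)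
  show "((\<lambda>n. g n / (1 / s n)) \<longlongrightarrow> 0) sequentially"
    using assms(1) by (simp add: mult.commute)
  have "eventually (\<lambda>n. 0 < s n) sequentially"
    using assms(2) by (auto simp: filterlim_at_top_dense)
  then show "eventually (\<lambda>n. 1 / s n \<noteq> 0) sequentially"
    by eventually_elim simp
qed

theorem theorem3p7:
  fixes M :: "'w measure" and K :: "'k measure"
    and \<beta> p :: real
    and f :: "'k \<Rightarrow> 'h::{real_inner, complete_space, second_countable_topology} \<Rightarrow> real"
    and k :: "'w \<Rightarrow> 'k" and F :: "'h \<Rightarrow> real" and \<psi> :: "real \<Rightarrow> real"
    and x :: "nat \<Rightarrow> 'w \<Rightarrow> 'h" and \<gamma> :: "nat \<Rightarrow> real" and kk :: "nat \<Rightarrow> 'w \<Rightarrow> 'k"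
  assumes prob: "prob_space M" and complete: "complete_measure M"
    and beta: "0 < \<beta>"
    and convex: "\<And>\<kappa>. \<kappa> \<in> space K \<Longrightarrow> convex_on UNIV (f \<kappa>)"
    and differentiable: "\<And>\<kappa> z. \<kappa> \<in> space K \<Longrightarrow> f \<kappa> differentiable (at z)"
    and lipschitz: "\<And>\<kappa>. \<kappa> \<in> space K \<Longrightarrow> \<beta>-lipschitz_on UNIV (grad (f \<kappa>))"
    and f_measurable: "(\<lambda>(\<kappa>, z). f \<kappa> z) \<in> borel_measurable (K \<Otimes>\<^sub>M borel)"
    and grad_measurable: "(\<lambda>(\<kappa>, z). grad (f \<kappa>) z) \<in> borel_measurable (K \<Otimes>\<^sub>M borel)"
    and k_rv: "k \<in> measurable M K"
    and f_integrable: "\<And>z. integrable M (\<lambda>\<omega>. f (k \<omega>) z)"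
    and F_eq: "\<And>z. F z = (\<integral>\<omega>. f (k \<omega>) z \<partial>M)"
    and argmin: "{z. \<forall>y. F z \<le> F y} \<noteq> {}"
    and psi_nonneg: "\<And>t. 0 \<le> t \<Longrightarrow> 0 \<le> \<psi> t"
    and psi_mono: "mono_on {0..} \<psi>"
    and psi_bound: "\<And>z. (\<integral>\<^sup>+\<omega>. ennreal ((norm (grad (f (k \<omega>)) z))\<^sup>2) \<partial>M) \<le> ennreal (\<psi> (norm z))"
    and x0_rv: "x 0 \<in> borel_measurable M"
    and x0_L2: "integrable M (\<lambda>\<omega>. (norm (x 0 \<omega>))\<^sup>2)"
    and p: "2 / 3 < p" "p \<le> 1"
    and gamma: "\<And>n. \<gamma> n = real (n + 1) powr (- p)"
    and kk_rv: "\<And>n. kk n \<in> measurable M K"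
    and kk_copy: "\<And>n. distr M K (kk n) = distr M K k"
    and kk_indep: "\<And>n. prob_space.indep_set M
                     {kk n -` A \<inter> space M | A. A \<in> sets K} (generated_events M x n)"
    and step: "\<And>n. AE \<omega> in M. x (Suc n) \<omega> = x n \<omega> - \<gamma> n *\<^sub>R grad (f (kk n \<omega>)) (x n \<omega>)"
  shows "AE \<omega> in M.
           (p < 1 \<longrightarrow> (\<lambda>n. F (x n \<omega>) - Inf (range F)) \<in> o(\<lambda>n. 1 / real n powr (1 - p))) \<and>
           (p = 1 \<longrightarrow> (\<lambda>n. F (x n \<omega>) - Inf (range F)) \<in> o(\<lambda>n. 1 / ln (real n)))"
proof -
  obtain zs where zs: "F zs \<le> F y" for y using argmin by blast
  interpret M: prob_space M by fact
  have grad_rv[measurable (raw)]: "(\<lambda>\<omega>. grad (f (u \<omega>)) (v \<omega>)) \<in> borel_measurable M"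
    if [measurable]: "u \<in> measurable M K" "v \<in> borel_measurable M" for u v
    using measurable_compose[OF _ grad_measurable, of "\<lambda>\<omega>. (u \<omega>, v \<omega>)" M] by simp
  \<comment> \<open>The recursion fixes \<open>x (Suc n)\<close> only up to a null set, so
    completeness of \<open>M\<close> enters here.\<close>
  have x_rv: "x n \<in> borel_measurable M" for n
  proof (induction n)
    case (Suc n)
    note [measurable] = Suc kk_rv
    show ?case
      by (rule complete_measure.borel_measurable_AE_eq[OF complete _ step[of n]]) measurable
  qed (fact x0_rv)
  interpret stochastic_gradient_descent M K \<beta> "\<psi> (norm zs)" f k zs x \<gamma> kk
  proof unfold_locales
    show "(\<integral>\<omega>. f (k \<omega>) zs \<partial>M) \<le> (\<integral>\<omega>. f (k \<omega>) z \<partial>M)" for z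
      using zs by (simp flip: F_eq)
    show "0 < \<gamma> n" for n by (simp add: gamma)
  qed (use assms x_rv in auto)
  have gap: "F z - Inf (range F) = gap z" for z
  proof -
    have "Inf (range F) = F zs" using zs by (intro cInf_eq_minimum) auto
    then show ?thesis by (simp add: gap_def F_eq)
  qed
  have gamma_sq: "(\<gamma> n)\<^sup>2 = real (Suc n) powr (- 2 * p)" for n
    by (simp only: gamma Suc_powr_square)
  have gamma_sq_summable: "summable (\<lambda>n. (\<gamma> n)\<^sup>2)"
    unfolding gamma_sq using p by (intro summable_Suc_powr) simp
  show ?thesis
  proof (cases "p < 1")
    case True
    let ?s = "\<lambda>n. real n powr (1 - p)"
    have s: "filterlim ?s at_top sequentially"
    proof (subst filterlim_cong[OF refl refl])
      \<comment> \<open>The two expressions agree only for positive \<open>n\<close>, because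
        \<open>0 powr (1 - p)\<close> is 0.\<close>
      show "eventually (\<lambda>n. ?s n = exp ((1 - p) * ln (real n))) sequentially"
        using eventually_gt_at_top[of 0] by eventually_elim (simp add: powr_def)
      show "filterlim (\<lambda>n. exp ((1 - p) * ln (real n))) at_top sequentially"
        using True
        by (intro filterlim_compose[OF exp_at_top] filterlim_tendsto_pos_mult_at_top[OF tendsto_const]
            filterlim_compose[OF ln_at_top filterlim_real_sequentially]) simp
    qed
    have "AE \<omega> in M. (\<lambda>n. ?s n * gap (x n \<omega>)) \<longlonglongrightarrow> 0"
    proof (rule weighted_gap_tendsto_0[OF s _ _ zero_le_one gamma_sq_summable])
      show "?s (Suc n) - ?s n \<le> 1 * \<gamma> n" for n
        using powr_increment_le[of p n] p by (simp add: gamma)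
      \<comment> \<open>Weight and squared step size combine to the exponent
        \<open>(1 - p) - 2 * p\<close>, which lies below -1 exactly when
        \<open>p > 2 / 3\<close>.\<close>
      have "summable (\<lambda>n. real (Suc n) powr (1 - 3 * p))"
        using p by (intro summable_Suc_powr) simp
      then show "summable (\<lambda>n. ?s (Suc n) * (\<gamma> n)\<^sup>2)"
        unfolding gamma_sq by (simp flip: powr_add)
    qed simp
    then show ?thesis
      using True s by (auto simp: gap elim!: eventually_mono intro!: smallo_inverse_of_tendsto_mult)
  next
    case False
    with p have [simp]: "p = 1" by simp
    let ?s = "\<lambda>n. ln (real n)"
    have s: "filterlim ?s at_top sequentially"
      by (intro filterlim_compose[OF ln_at_top filterlim_real_sequentially])
    have "AE \<omega> in M. (\<lambda>n. ?s n * gap (x n \<omega>)) \<longlonglongrightarrow> 0"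
    \<comment> \<open>\<open>C = 2\<close> is the constant of \<open>ln_increment_le\<close>;
      nonnegativity of the weight at \<open>n = 0\<close> again relies on
      \<open>ln 0 = 0\<close>.\<close>
    proof (rule weighted_gap_tendsto_0[OF s, where C = 2])
      show "0 \<le> ?s n" for n by (cases "n = 0") auto
      show "?s (Suc n) - ?s n \<le> 2 * \<gamma> n" for n
        using ln_increment_le[of n] by (simp add: gamma)
      show "summable (\<lambda>n. ?s (Suc n) * (\<gamma> n)\<^sup>2)"
        using summable_ln_Suc_mult_powr by (simp add: gamma_sq)
    qed (simp_all add: gamma_sq_summable)
    then show ?thesis
      using s by (auto simp: gap elim!: eventually_mono intro!: smallo_inverse_of_tendsto_mult)
  qed
qed

end
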